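(* Let $I$ and $J$ be ideals of positive grade in the ring $R$. Then $$\operatorname{tr}(I)\operatorname{tr}(J)\subseteq\operatorname{tr}(IJ)\subseteq\operatorname{tr}(I)\cap\operatorname{tr}(J).$$
   Context: $R$ is a commutative ring. An ideal has positive grade if it contains an element that is a nonzerodivisor on $R$. For an $R$-module $M$, $\operatorname{tr}(M)=\sum_{\varphi\in\operatorname{Hom}_R(M,R)}\varphi(M)$, an ideal of $R$; ideals of $R$ are regarded as $R$-modules. *)

theory Defs
  imports "HOL-Algebra.Module" "HOL-Algebra.Ideal_Product"
begin

definition nonzerodivisor :: "('a, 'm) ring_scheme \<Rightarrow> 'a \<Rightarrow> bool"
  where "nonzerodivisor R x \<longleftrightarrow>
    x \<in> carrier R \<and> (\<forall>y \<in> carrier R. x \<otimes>\<^bsub>R\<^esub> y = \<zero>\<^bsub>R\<^esub> \<longrightarrow> y = \<zero>\<^bsub>R\<^esub>)"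

definition positive_grade :: "('a, 'm) ring_scheme \<Rightarrow> 'a set \<Rightarrow> bool"
  where "positive_grade R I \<longleftrightarrow> (\<exists>x \<in> I. nonzerodivisor R x)"

definition regular_module :: "('a, 'm) ring_scheme \<Rightarrow> ('a, 'a) module"
  where "regular_module R =
    \<lparr>carrier = carrier R, mult = mult R, one = one R, zero = zero R, add = add R,
     smult = mult R\<rparr>"

definition ideal_module :: "('a, 'm) ring_scheme \<Rightarrow> 'a set \<Rightarrow> ('a, 'a) module"
  where "ideal_module R I = (regular_module R)\<lparr>carrier := I\<rparr>"

text \<open>As with \<^const>\<open>hom\<close>, elements of \<open>Hom_module R M N\<close> are unconstrained outside
  \<open>carrier M\<close>.\<close>

definition Hom_module ::
    "('r, 'm) ring_scheme \<Rightarrow> ('r, 'a, 'n) module_scheme \<Rightarrow> ('r, 'b, 'k) module_scheme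
      \<Rightarrow> ('a \<Rightarrow> 'b) set"
  where "Hom_module R M N =
    {h \<in> hom (add_monoid M) (add_monoid N).
       \<forall>a \<in> carrier R. \<forall>x \<in> carrier M. h (a \<odot>\<^bsub>M\<^esub> x) = a \<odot>\<^bsub>N\<^esub> h x}"

definition family_sum :: "('a, 'm) ring_scheme \<Rightarrow> ('i \<Rightarrow> 'a set) \<Rightarrow> 'i set \<Rightarrow> 'a set"
  where "family_sum R A S =
    {finsum R y F | y F. finite F \<and> F \<subseteq> S \<and> (\<forall>i \<in> F. y i \<in> A i)}"

definition trace_ideal ::
    "('r, 'm) ring_scheme \<Rightarrow> ('r, 'a, 'n) module_scheme \<Rightarrow> 'r set"
  where "trace_ideal R M =
    family_sum R (\<lambda>\<phi>. \<phi> ` carrier M) (Hom_module R M (regular_module R))"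

lemma (in cring) regular_module_is_module: "module R (regular_module R)"
proof -
  have "abelian_group (regular_module R)"
    by (rule abelian_groupI)
      (auto simp: regular_module_def a_ac intro: l_neg a_inv_closed)
  then show ?thesis
    by (intro moduleI is_cring) (simp_all add: regular_module_def l_distr r_distr m_assoc)
qed

lemma (in cring) ideal_module_is_module:
  assumes "ideal I R"
  shows "module R (ideal_module R I)"
proof -
  interpret I: ideal I R by fact
  interpret M: module R "regular_module R" by (rule regular_module_is_module)
  have carr: "x \<in> carrier R" if "x \<in> I" for x
    using that by (rule I.Icarr)
  have minus: "\<ominus>\<^bsub>regular_module R\<^esub> x = \<ominus> x" if "x \<in> I" for x
    by (rule M.minus_equality) (use carr[OF that] in \<open>simp_all add: regular_module_def l_neg\<close>)
  have "submodule I R (regular_module R)"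
    by (rule M.submoduleI)
      (auto simp: minus carr, auto simp: regular_module_def carr I.I_l_closed)
  then show ?thesis
    unfolding ideal_module_def
    by (rule submodule.submodule_is_module) (rule regular_module_is_module)
qed

end

theory Submission
  imports Defs
begin

text \<open>
  If \<open>\<phi> : I J \<rightarrow> R\<close> is linear and \<open>j \<in> J\<close>, then \<open>i \<mapsto> \<phi> (i j)\<close> is a linear form on \<open>I\<close>, so
  \<open>\<phi> (i j) \<in> tr I\<close>; this gives the second inclusion. For the first one, let \<open>f\<close> and \<open>g\<close> be
  linear forms on \<open>I\<close> and \<open>J\<close>, and let \<open>x \<in> I\<close>, \<open>y \<in> J\<close> be nonzerodivisors. Since
  \<open>x f i = i f x\<close> and \<open>y g j = j g y\<close>, the equation \<open>x y h z = z f x g y\<close> has, for every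
  \<open>z \<in> I J\<close>, a solution \<open>h z\<close>, which is unique because \<open>x y\<close> is a nonzerodivisor. Hence \<open>h\<close> is
  a linear form on \<open>I J\<close> with \<open>h (i j) = f i g j\<close>.
\<close>

section \<open>Linear forms on an ideal\<close>

lemma Hom_ideal_module_iff:
  "f \<in> Hom_module R (ideal_module R I) (regular_module R) \<longleftrightarrow>
    f \<in> I \<rightarrow> carrier R \<and>
    (\<forall>x \<in> I. \<forall>y \<in> I. f (x \<oplus>\<^bsub>R\<^esub> y) = f x \<oplus>\<^bsub>R\<^esub> f y) \<and>
    (\<forall>a \<in> carrier R. \<forall>x \<in> I. f (a \<otimes>\<^bsub>R\<^esub> x) = a \<otimes>\<^bsub>R\<^esub> f x)"
  by (auto simp: Hom_module_def hom_def ideal_module_def regular_module_def)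

lemma (in cring) Hom_ideal_module_zero:
  assumes "ideal I R" and "f \<in> Hom_module R (ideal_module R I) (regular_module R)"
  shows "f \<zero> = \<zero>"
proof -
  interpret ideal I R by fact
  have "f (\<zero> \<otimes> \<zero>) = \<zero> \<otimes> f \<zero>" "f \<zero> \<in> carrier R"
    using assms(2) unfolding Hom_ideal_module_iff by (blast intro: zero_closed)+
  then show ?thesis by simp
qed

section \<open>Additive structure of the trace\<close>

text \<open>Induction on the index set: the empty sum is zero and each further summand is a value of
  a form. \<open>N\<close> is left general because it serves later both as a trace ideal and as a
  set of elements multiplying something into one.\<close>

lemma (in cring) trace_ideal_subset:
  assumes N: "N \<subseteq> carrier R" "\<zero> \<in> N" "\<And>a b. a \<in> N \<Longrightarrow> b \<in> N \<Longrightarrow> a \<oplus> b \<in> N"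
    and hom: "\<And>f m. f \<in> Hom_module R M (regular_module R) \<Longrightarrow> m \<in> carrier M \<Longrightarrow> f m \<in> N"
  shows "trace_ideal R M \<subseteq> N"
proof -
  have "finsum R y F \<in> N"
    if "finite F" "F \<subseteq> Hom_module R M (regular_module R)" "\<forall>f \<in> F. y f \<in> f ` carrier M" for y F
    using that
  proof (induction F rule: finite_induct)
    case empty
    then show ?case using N by simp
  next
    case (insert f F)
    have "y h \<in> N" if "h \<in> insert f F" for h
    proof -
      have "h \<in> Hom_module R M (regular_module R)" "y h \<in> h ` carrier M"
        using insert.prems that by auto
      then show ?thesis using hom by auto
    qed
    with N(1) have "y f \<in> N" "y \<in> F \<rightarrow> carrier R" "y f \<in> carrier R" by auto
    moreover have "finsum R y F \<in> N" using insert by simp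
    ultimately show ?case using insert.hyps by (simp add: finsum_insert N(3))
  qed
  then show ?thesis by (auto simp: trace_ideal_def family_sum_def)
qed

lemma (in cring) zero_in_trace_ideal: "\<zero> \<in> trace_ideal R M"
  unfolding trace_ideal_def family_sum_def
  by (auto intro!: exI[of _ "\<lambda>_. \<zero>"] exI[of _ "{}"])

lemma (in cring) hom_value_in_trace_ideal:
  assumes "f \<in> Hom_module R M (regular_module R)" and "m \<in> carrier M"
  shows "f m \<in> trace_ideal R M"
proof -
  have "f m \<in> carrier R"
    using assms by (auto simp: Hom_module_def hom_def regular_module_def)
  then have "f m = finsum R (\<lambda>_. f m) {f}" by simp
  with assms show ?thesis
    unfolding trace_ideal_def family_sum_def
    by (intro CollectI exI[of _ "\<lambda>_. f m"] exI[of _ "{f}"]) auto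
qed

lemma (in cring) trace_ideal_subset_carrier: "trace_ideal R M \<subseteq> carrier R"
  by (rule trace_ideal_subset) (auto simp: Hom_module_def hom_def regular_module_def)

text \<open>\<open>family_sum\<close> allows one summand per form, so two sums cannot simply be
  concatenated when a form occurs in both. They are merged form by form, using
  \<open>f s \<oplus> f t = f (s \<oplus> t)\<close>.\<close>

lemma (in cring) trace_ideal_add_closed:
  assumes I: "ideal I R"
    and "a \<in> trace_ideal R (ideal_module R I)" "b \<in> trace_ideal R (ideal_module R I)"
  shows "a \<oplus> b \<in> trace_ideal R (ideal_module R I)"
proof -
  interpret I: ideal I R by fact
  let ?H = "Hom_module R (ideal_module R I) (regular_module R)"
  have carr: "carrier (ideal_module R I) = I" by (simp add: ideal_module_def)
  from assms obtain y F z G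
    where F: "finite F" "F \<subseteq> ?H" "\<forall>f \<in> F. y f \<in> f ` I" "a = finsum R y F"
      and G: "finite G" "G \<subseteq> ?H" "\<forall>f \<in> G. z f \<in> f ` I" "b = finsum R z G"
    unfolding trace_ideal_def family_sum_def carr by auto
  \<comment> \<open>Padding by zero brings both sums to the index set \<open>F \<union> G\<close>.
    The padded values are still values of the forms, because
    \<open>f \<zero> = \<zero>\<close>.\<close>
  define y' where "y' = (\<lambda>f. if f \<in> F then y f else \<zero>)"
  define z' where "z' = (\<lambda>f. if f \<in> G then z f else \<zero>)"
  have zero: "\<zero> \<in> f ` I" if "f \<in> ?H" for f
    using Hom_ideal_module_zero[OF I that] I.zero_closed by (metis imageI)
  have y': "y' f \<in> f ` I" and z': "z' f \<in> f ` I" if "f \<in> F \<union> G" for f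
    using that F G zero by (auto simp: y'_def z'_def)
  have image: "f ` I \<subseteq> carrier R" if "f \<in> F \<union> G" for f
  proof -
    have "f \<in> ?H" using that F(2) G(2) by blast
    then show ?thesis by (auto simp: Hom_ideal_module_iff)
  qed
  have yz: "y' \<in> F \<union> G \<rightarrow> carrier R" "z' \<in> F \<union> G \<rightarrow> carrier R"
    using y' z' image by blast+
  have "y \<in> F \<rightarrow> carrier R" "z \<in> G \<rightarrow> carrier R"
    using F(3) G(3) image by blast+
  then have "a = finsum R y' F" "b = finsum R z' G"
    unfolding F(4) G(4) by (auto simp: y'_def z'_def intro!: finsum_cong')
  moreover have "finsum R y' F = finsum R y' (F \<union> G)" "finsum R z' G = finsum R z' (F \<union> G)"
    using F(1) G(1) yz
    by (auto simp: y'_def z'_def intro!: add.finprod_mono_neutral_cong_left)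
  ultimately have "a \<oplus> b = finsum R (\<lambda>f. y' f \<oplus> z' f) (F \<union> G)"
    using finsum_addf[OF yz] by simp
  moreover have "y' f \<oplus> z' f \<in> f ` I" if "f \<in> F \<union> G" for f
  proof -
    obtain s t where "s \<in> I" "t \<in> I" "y' f = f s" "z' f = f t"
      using y' z' \<open>f \<in> F \<union> G\<close> by (metis imageE)
    moreover have "f \<in> ?H" using that F(2) G(2) by blast
    ultimately have "y' f \<oplus> z' f = f (s \<oplus> t)" "s \<oplus> t \<in> I"
      by (auto simp: Hom_ideal_module_iff)
    then show ?thesis by blast
  qed
  ultimately show ?thesis
    unfolding trace_ideal_def family_sum_def carr using F(1,2) G(1,2)
    by (intro CollectI exI[of _ "\<lambda>f. y' f \<oplus> z' f"] exI[of _ "F \<union> G"]) auto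
qed

lemma (in cring) trace_ideal_prod_subset:
  assumes I: "ideal I R" and J: "ideal J R"
  shows "trace_ideal R (ideal_module R (I \<cdot> J)) \<subseteq> trace_ideal R (ideal_module R I)"
proof (rule trace_ideal_subset)
  interpret I: ideal I R by fact
  interpret J: ideal J R by fact
  fix f z
  assume f: "f \<in> Hom_module R (ideal_module R (I \<cdot> J)) (regular_module R)"
    and "z \<in> carrier (ideal_module R (I \<cdot> J))"
  then have "z \<in> I \<cdot> J" by (simp add: ideal_module_def)
  then show "f z \<in> trace_ideal R (ideal_module R I)"
  proof (induction z rule: ideal_prod.induct)
    case (prod i j)
    have "(\<lambda>i. f (i \<otimes> j)) \<in> Hom_module R (ideal_module R I) (regular_module R)"
      using f prod(2)
      by (auto simp: Hom_ideal_module_iff l_distr m_assoc I.Icarr J.Icarr ideal_prod.prod Pi_iff)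
    from hom_value_in_trace_ideal[OF this, of i] prod(1) show ?case
      by (simp add: ideal_module_def)
  next
    case (sum s t)
    then have "f (s \<oplus> t) = f s \<oplus> f t"
      using f by (simp add: Hom_ideal_module_iff)
    with sum show ?case by (simp add: trace_ideal_add_closed[OF I])
  qed
qed (use I in \<open>simp_all add: trace_ideal_subset_carrier zero_in_trace_ideal
       trace_ideal_add_closed\<close>)

section \<open>Nonzerodivisors and the product of two linear forms\<close>

lemma (in cring) nonzerodivisor_mult:
  assumes "nonzerodivisor R x" and "nonzerodivisor R y"
  shows "nonzerodivisor R (x \<otimes> y)"
  using assms unfolding nonzerodivisor_def by (metis m_assoc m_closed)

lemma (in cring) nonzerodivisor_cancel:
  assumes "nonzerodivisor R x" "a \<in> carrier R" "b \<in> carrier R" "x \<otimes> a = x \<otimes> b"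
  shows "a = b"
proof -
  have x: "x \<in> carrier R" using assms(1) by (simp add: nonzerodivisor_def)
  have "x \<otimes> (a \<ominus> b) = x \<otimes> a \<ominus> x \<otimes> b"
    using x assms(2,3) by algebra
  also have "\<dots> = \<zero>" using x assms(2-4) by (simp add: r_neg minus_eq)
  finally have "a \<ominus> b = \<zero>"
    using assms(1-3) unfolding nonzerodivisor_def by (blast intro: minus_closed)
  moreover have "a = (a \<ominus> b) \<oplus> b" using assms(2,3) by (simp add: minus_eq a_assoc l_neg)
  ultimately show ?thesis using assms(3) by simp
qed

text \<open>Both sides equal \<open>f (x \<otimes> i)\<close>. When \<open>x\<close> is a
  nonzerodivisor, this says that \<open>f\<close> is multiplication by the fraction
  \<open>f x / x\<close>.\<close>

lemma (in cring) Hom_ideal_module_swap: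
  assumes "ideal I R" and f: "f \<in> Hom_module R (ideal_module R I) (regular_module R)"
    and "x \<in> I" "i \<in> I"
  shows "x \<otimes> f i = i \<otimes> f x"
proof -
  interpret I: ideal I R by fact
  have "x \<otimes> f i = f (x \<otimes> i)" "i \<otimes> f x = f (i \<otimes> x)"
    using f assms(3,4) by (simp_all add: Hom_ideal_module_iff I.Icarr)
  then show ?thesis using assms(3,4) by (simp add: m_comm I.Icarr)
qed

text \<open>In the total ring of fractions, \<open>h\<close> is multiplication by
  \<open>c / (x \<otimes> y)\<close>, the product of the fractions that represent \<open>f\<close>
  and \<open>g\<close>. The proof stays in \<open>R\<close> by working with the cleared equation
  \<open>x \<otimes> y \<otimes> h z = z \<otimes> c\<close>.\<close>

lemma (in cring) Hom_ideal_prod_extend: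
  assumes I: "ideal I R" "positive_grade R I" and J: "ideal J R" "positive_grade R J"
    and f: "f \<in> Hom_module R (ideal_module R I) (regular_module R)"
    and g: "g \<in> Hom_module R (ideal_module R J) (regular_module R)"
  obtains h where "h \<in> Hom_module R (ideal_module R (I \<cdot> J)) (regular_module R)"
    and "\<And>i j. i \<in> I \<Longrightarrow> j \<in> J \<Longrightarrow> h (i \<otimes> j) = f i \<otimes> g j"
proof -
  interpret I: ideal I R by fact
  interpret J: ideal J R by fact
  interpret IJ: ideal "I \<cdot> J" R by (rule ideal_prod_is_ideal) fact+
  obtain x y where x: "x \<in> I" "nonzerodivisor R x" and y: "y \<in> J" "nonzerodivisor R y"
    using I J by (auto simp: positive_grade_def)
  define c where "c = f x \<otimes> g y"
  have f_closed [simp]: "f i \<in> carrier R" if "i \<in> I" for i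
    using f that by (auto simp: Hom_ideal_module_iff)
  have g_closed [simp]: "g j \<in> carrier R" if "j \<in> J" for j
    using g that by (auto simp: Hom_ideal_module_iff)
  have xy [simp]: "x \<in> carrier R" "y \<in> carrier R" "c \<in> carrier R"
    using x y by (auto simp: c_def)
  have nzd: "nonzerodivisor R (x \<otimes> y)"
    using x y by (simp add: nonzerodivisor_mult)
  have fg: "x \<otimes> y \<otimes> (f i \<otimes> g j) = i \<otimes> j \<otimes> c" if "i \<in> I" "j \<in> J" for i j
  proof -
    have "x \<otimes> y \<otimes> (f i \<otimes> g j) = (x \<otimes> f i) \<otimes> (y \<otimes> g j)"
      using that by (simp add: m_ac)
    also have "\<dots> = (i \<otimes> f x) \<otimes> (j \<otimes> g y)"
      using that f g x y I J by (simp add: Hom_ideal_module_swap)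
    finally show ?thesis
      using that x y by (simp add: c_def m_ac I.Icarr J.Icarr)
  qed
  \<comment> \<open>The fraction maps \<open>I \<cdot> J\<close> into \<open>R\<close>: on a product
    \<open>i \<otimes> j\<close> a solution is \<open>f i \<otimes> g j\<close>, and solutions for
    two summands add up.\<close>
  have "\<exists>w. w \<in> carrier R \<and> x \<otimes> y \<otimes> w = z \<otimes> c" if "z \<in> I \<cdot> J" for z
    using that
  proof (induction z rule: ideal_prod.induct)
    case (prod i j)
    with fg show ?case
      by (intro exI[of _ "f i \<otimes> g j"]) simp
  next
    case (sum s t)
    then obtain v w where "v \<in> carrier R" "x \<otimes> y \<otimes> v = s \<otimes> c" "w \<in> carrier R" "x \<otimes> y \<otimes> w = t \<otimes> c"
      by blast
    then show ?case
      using sum.hyps by (intro exI[of _ "v \<oplus> w"]) (simp add: r_distr l_distr IJ.Icarr)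
  qed
  then obtain h where h: "\<And>z. z \<in> I \<cdot> J \<Longrightarrow> h z \<in> carrier R"
      "\<And>z. z \<in> I \<cdot> J \<Longrightarrow> x \<otimes> y \<otimes> h z = z \<otimes> c"
    by metis
  \<comment> \<open>Uniqueness of the solution: additivity, homogeneity and the values on products
    all follow by checking that the proposed value solves the equation.\<close>
  have h_eq: "h z = w" if "z \<in> I \<cdot> J" "w \<in> carrier R" "x \<otimes> y \<otimes> w = z \<otimes> c" for z w
    using nonzerodivisor_cancel[OF nzd, of "h z" w] that h by simp
  have "h \<in> Hom_module R (ideal_module R (I \<cdot> J)) (regular_module R)"
    unfolding Hom_ideal_module_iff
  proof (intro conjI ballI)
    show "h \<in> I \<cdot> J \<rightarrow> carrier R" using h by blast
  next
    fix s t assume "s \<in> I \<cdot> J" "t \<in> I \<cdot> J"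
    then show "h (s \<oplus> t) = h s \<oplus> h t"
      by (intro h_eq) (simp_all add: h r_distr l_distr IJ.Icarr)
  next
    fix a s assume a: "a \<in> carrier R" and s: "s \<in> I \<cdot> J"
    have "x \<otimes> y \<otimes> (a \<otimes> h s) = a \<otimes> (x \<otimes> y \<otimes> h s)"
      using a s h(1) by (simp add: m_ac)
    then show "h (a \<otimes> s) = a \<otimes> h s"
      using a s h by (intro h_eq) (simp_all add: IJ.I_l_closed m_assoc IJ.Icarr)
  qed
  moreover have "h (i \<otimes> j) = f i \<otimes> g j" if "i \<in> I" "j \<in> J" for i j
    using that fg by (intro h_eq) (simp_all add: ideal_prod.prod)
  ultimately show thesis by (rule that)
qed

section \<open>Products of traces\<close>

text \<open>Products of single values \<open>f i \<otimes> g j\<close> are values of one form on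
  \<open>I \<cdot> J\<close>. Distributivity then extends this to sums, one factor at a
  time.\<close>

lemma (in cring) trace_ideal_prod_supset:
  assumes I: "ideal I R" "positive_grade R I" and J: "ideal J R" "positive_grade R J"
  shows "trace_ideal R (ideal_module R I) \<cdot> trace_ideal R (ideal_module R J)
    \<subseteq> trace_ideal R (ideal_module R (I \<cdot> J))"
proof
  let ?tr = "\<lambda>I. trace_ideal R (ideal_module R I)"
  have IJ: "ideal (I \<cdot> J) R" by (rule ideal_prod_is_ideal) fact+
  note T = zero_in_trace_ideal trace_ideal_add_closed[OF IJ]
  have gen: "f i \<otimes> g j \<in> ?tr (I \<cdot> J)"
    if f: "f \<in> Hom_module R (ideal_module R I) (regular_module R)" and i: "i \<in> I"
      and g: "g \<in> Hom_module R (ideal_module R J) (regular_module R)" and j: "j \<in> J" for f g i j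
  proof -
    obtain h where h: "h \<in> Hom_module R (ideal_module R (I \<cdot> J)) (regular_module R)"
      "h (i \<otimes> j) = f i \<otimes> g j"
      using Hom_ideal_prod_extend[OF I J f g] i j by metis
    then show ?thesis
      using hom_value_in_trace_ideal[OF h(1), of "i \<otimes> j"] i j
      by (simp add: ideal_module_def ideal_prod.prod)
  qed
  \<comment> \<open>With \<open>f i\<close> fixed, the elements that it multiplies into the trace of
    \<open>I \<cdot> J\<close> are closed under addition, so testing the values \<open>g j\<close>
    suffices.\<close>
  have right: "?tr J \<subseteq> {b \<in> carrier R. f i \<otimes> b \<in> ?tr (I \<cdot> J)}"
    if f: "f \<in> Hom_module R (ideal_module R I) (regular_module R)" and i: "i \<in> I" for f i
  proof -
    have fi: "f i \<in> carrier R" using f i by (auto simp: Hom_ideal_module_iff)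
    show ?thesis
    proof (rule trace_ideal_subset)
      fix g j assume g: "g \<in> Hom_module R (ideal_module R J) (regular_module R)"
        and "j \<in> carrier (ideal_module R J)"
      then have j: "j \<in> J" by (simp add: ideal_module_def)
      then have "g j \<in> carrier R" using g by (auto simp: Hom_ideal_module_iff)
      then show "g j \<in> {b \<in> carrier R. f i \<otimes> b \<in> ?tr (I \<cdot> J)}"
        using gen[OF f i g j] by simp
    qed (use fi in \<open>auto simp: T r_distr\<close>)
  qed
  have trJ: "b \<in> carrier R" if "b \<in> ?tr J" for b
    using that trace_ideal_subset_carrier[of "ideal_module R J"] by (rule rev_subsetD)
  \<comment> \<open>The same argument in the other factor, now against all of \<open>?tr J\<close>;
    \<open>right\<close> settles the values \<open>f i\<close>.\<close>
  have left: "?tr I \<subseteq> {a \<in> carrier R. \<forall>b \<in> ?tr J. a \<otimes> b \<in> ?tr (I \<cdot> J)}"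
  proof (rule trace_ideal_subset)
    fix f i assume f: "f \<in> Hom_module R (ideal_module R I) (regular_module R)"
      and "i \<in> carrier (ideal_module R I)"
    then have i: "i \<in> I" by (simp add: ideal_module_def)
    then have "f i \<in> carrier R" using f by (auto simp: Hom_ideal_module_iff)
    with subsetD[OF right[OF f i]]
    show "f i \<in> {a \<in> carrier R. \<forall>b \<in> ?tr J. a \<otimes> b \<in> ?tr (I \<cdot> J)}" by simp
  qed (auto simp: T l_distr trJ)
  fix z assume "z \<in> ?tr I \<cdot> ?tr J"
  then show "z \<in> ?tr (I \<cdot> J)"
  proof (induction z rule: ideal_prod.induct)
    case (prod a b)
    then show ?case using subsetD[OF left] by simp
  next
    case (sum s t)
    then show ?case by (simp add: T)
  qed
qed

theorem proposition1p4:
  fixes R :: "('a, 'm) ring_scheme" and I J :: "'a set"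
  assumes "cring R"
    and "ideal I R" and "positive_grade R I"
    and "ideal J R" and "positive_grade R J"
  shows "trace_ideal R (ideal_module R I) \<cdot>\<^bsub>R\<^esub> trace_ideal R (ideal_module R J)
           \<subseteq> trace_ideal R (ideal_module R (I \<cdot>\<^bsub>R\<^esub> J))
       \<and> trace_ideal R (ideal_module R (I \<cdot>\<^bsub>R\<^esub> J))
           \<subseteq> trace_ideal R (ideal_module R I) \<inter> trace_ideal R (ideal_module R J)"
proof -
  interpret cring R by fact
  \<comment> \<open>Commutativity turns the inclusion into the trace of the first factor into the
    one for the second.\<close>
  have "I \<cdot>\<^bsub>R\<^esub> J = J \<cdot>\<^bsub>R\<^esub> I"
    using assms by (simp add: ideal_prod_commute)
  then show ?thesis
    using trace_ideal_prod_supset[OF assms(2-5)] trace_ideal_prod_subset[OF assms(2,4)]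
      trace_ideal_prod_subset[OF assms(4,2)]
    by simp
qed

end
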